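(* Let $\mathbb{K}\in\{\mathbb{R},\mathbb{C}\}$ and let $X$ be one of the spaces $Mat_{m\times n}(\mathbb{K})$ of $m\times n$ matrices, $Mat^{sym}_{n\times n}(\mathbb{K})$ of symmetric $n\times n$ matrices, or $Mat^{skew\text{-}sym}_{n\times n}(\mathbb{K})$ of skew-symmetric $n\times n$ matrices (in the last two cases $m=n$). For an integer $r$ let $X_r=\{A\in X : \operatorname{rank}(A)=r\}$ and let $\overline{X_r}$ be its closure. Then for any $1\le r\le m\le n$ and any $A,B\in\overline{X_r}$, $$\frac{d_{in}^{\overline{X_r}}(A,B)}{2\sqrt{2}}\ \le\ d_{out}(A,B)\ \le\ d_{in}^{\overline{X_r}}(A,B).$$
   Context: The space $Mat_{m\times n}(\mathbb{K})\cong\mathbb{K}^{mn}$ carries the inner product $\langle A,B\rangle=\operatorname{trace}(A\overline{B}^{t})$, and $d_{out}(A,B)=\sqrt{\operatorname{trace}\big((A-B)\overline{(A-B)}^{t}\big)}$ is the corresponding Euclidean distance. For a subset $Y$ of a Euclidean space and $x,y\in Y$, the inner distance $d_{in}^{Y}(x,y)$ is the infimum of the Euclidean lengths of rectifiable paths $\gamma:[0,1]\to Y$ with $\gamma(0)=x$, $\gamma(1)=y$. *)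

theory Defs
  imports "HOL-Analysis.Analysis"
begin

text \<open>Length of a curve on \<open>[0,1]\<close>: the supremum of the lengths of its inscribed polygons.
  It is \<open>\<infinity>\<close> exactly when the curve is not of bounded variation.\<close>

definition path_length :: "(real \<Rightarrow> 'a::metric_space) \<Rightarrow> ennreal" where
  "path_length \<gamma> =
     (SUP ts \<in> {ts. sorted ts \<and> set ts \<subseteq> {0..1}}.
        \<Sum>i<length ts - 1. ennreal (dist (\<gamma> (ts ! i)) (\<gamma> (ts ! Suc i))))"

definition rectifiable_path :: "(real \<Rightarrow> 'a::metric_space) \<Rightarrow> bool" where
  "rectifiable_path \<gamma> \<longleftrightarrow> path \<gamma> \<and> path_length \<gamma> < \<infinity>"

text \<open>The infimum is taken in \<^typ>\<open>ennreal\<close>, so it is \<open>\<infinity>\<close> when no rectifiable path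
  in \<open>Y\<close> joins the two points.\<close>

definition inner_dist :: "'a::metric_space set \<Rightarrow> 'a \<Rightarrow> 'a \<Rightarrow> ennreal" where
  "inner_dist Y x y =
     (INF \<gamma> \<in> {\<gamma>. rectifiable_path \<gamma> \<and> path_image \<gamma> \<subseteq> Y \<and>
                   pathstart \<gamma> = x \<and> pathfinish \<gamma> = y}. path_length \<gamma>)"

definition inner_real :: "real^'n^'m \<Rightarrow> real^'n^'m \<Rightarrow> real" where
  "inner_real A B = trace (A ** transpose B)"

definition inner_complex :: "complex^'n^'m \<Rightarrow> complex^'n^'m \<Rightarrow> complex" where
  "inner_complex A B = trace (A ** transpose (map_matrix cnj B))"

definition d_out_real :: "real^'n^'m \<Rightarrow> real^'n^'m \<Rightarrow> real" where
  "d_out_real A B = sqrt (inner_real (A - B) (A - B))"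

text \<open>The trace of \<open>C C\<^sup>*\<close> is a nonnegative real number; \<^const>\<open>Re\<close> only adjusts the type.\<close>

definition d_out_complex :: "complex^'n^'m \<Rightarrow> complex^'n^'m \<Rightarrow> real" where
  "d_out_complex A B = sqrt (Re (inner_complex (A - B) (A - B)))"

text \<open>These distances are the library metric on matrices, so that \<^const>\<open>closure\<close>,
  \<^const>\<open>path\<close> and \<^const>\<open>path_length\<close> refer to the same Euclidean structure.\<close>

lemma d_out_real_eq_dist: "d_out_real A B = dist A B"
  by (simp add: d_out_real_def inner_real_def trace_def matrix_matrix_mult_def transpose_def
      dist_norm norm_vec_def L2_set_def sum_nonneg power2_eq_square)

lemma inner_complex_self:
  "inner_complex C C = complex_of_real ((norm C)\<^sup>2)"
  by (simp add: inner_complex_def trace_def matrix_matrix_mult_def transpose_def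
      norm_vec_def L2_set_def sum_nonneg complex_mult_cnj cmod_power2)

lemma d_out_complex_eq_dist: "d_out_complex A B = dist A B"
  by (simp add: d_out_complex_def inner_complex_self dist_norm)

definition symmetric_matrices :: "('k::field^'n^'n) set" where
  "symmetric_matrices = {A. transpose A = A}"

definition skew_symmetric_matrices :: "('k::field^'n^'n) set" where
  "skew_symmetric_matrices = {A. transpose A = - A}"

definition rank_stratum :: "('k::field^'n^'m) set \<Rightarrow> nat \<Rightarrow> ('k^'n^'m) set" where
  "rank_stratum X r = {A \<in> X. rank A = r}"

end

theory Submission
  imports Defs "HOL-Computational_Algebra.Polynomial"
begin

text \<open>Let \<open>P\<close> be the orthogonal projector onto the column space of \<open>B\<close>, and let \<open>Q = P\<^sup>T\<close> for
  (skew-)symmetric matrices and \<open>Q = I\<close> for general ones, so that \<open>B = P B Q\<close>. Contracting \<open>P\<close>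
  and \<open>Q\<close> from the identity deforms \<open>A\<close> to \<open>P A Q\<close> without raising the rank, and the segment from
  \<open>P A Q\<close> to \<open>B\<close> stays among matrices of the form \<open>B N\<close>. The pieces \<open>P A Q - B\<close>,
  \<open>b = P A (I - Q) + (I - P) A Q\<close> and \<open>c = (I - P) A (I - Q)\<close> of \<open>A - B\<close> are pairwise orthogonal,
  and the path has length at most the sum of their norms, hence at most \<open>\<surd>3\<close> times the norm of
  \<open>A - B\<close>. The closure of a stratum is never computed: if \<open>A\<close> and \<open>B\<close> have rank exactly \<open>r\<close>,
  all but finitely many points of the path have rank \<open>r\<close>, and the general case follows from
  compactness of the set of projectors.\<close>

section \<open>Closures, curve length and inner distance\<close>

text \<open>A finite set of reals has dense complement, and continuity maps closure into closure.
  This turns rank conditions that fail at finitely many parameters into closure membership for every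
  parameter.\<close>

lemma closure_cofiniteI:
  fixes f :: "real \<Rightarrow> 'a::topological_space"
  assumes "continuous_on UNIV f" "finite F" "\<And>t. t \<notin> F \<Longrightarrow> f t \<in> S"
  shows "f t \<in> closure S"
proof -
  have "interior F = {}"
    using assms(2) by (meson interior_subset finite_subset finite_imp_not_open open_interior)
  then have "t \<in> closure (- F)" by (simp add: closure_complement)
  moreover have "f ` closure (- F) \<subseteq> closure S"
    using assms closure_subset
    by (intro image_closure_subset) (auto intro: continuous_on_subset)
  ultimately show ?thesis by blast
qed

text \<open>Increments of \<open>g\<close> dominate every chord and telescope along any inscribed
  polygon; the ends are absorbed because \<open>g\<close> is monotone on the unit interval.\<close>

lemma path_length_le:
  fixes \<gamma> :: "real \<Rightarrow> 'a::metric_space"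
  assumes "\<And>s t. \<lbrakk>0 \<le> s; s \<le> t; t \<le> 1\<rbrakk> \<Longrightarrow> dist (\<gamma> s) (\<gamma> t) \<le> g t - g s"
  shows "path_length \<gamma> \<le> ennreal (g 1 - g 0)"
  unfolding path_length_def
proof (rule SUP_least)
  fix ts :: "real list"
  assume "ts \<in> {ts. sorted ts \<and> set ts \<subseteq> {0..1}}"
  then have ts: "sorted ts" "set ts \<subseteq> {0..1}" by auto
  have mono: "g s \<le> g t" if "0 \<le> s" "s \<le> t" "t \<le> 1" for s t
    using assms[OF that] zero_le_dist[of "\<gamma> s" "\<gamma> t"] by linarith
  have mem: "0 \<le> ts ! i" "ts ! i \<le> 1" if "i < length ts" for i
    using ts(2) nth_mem[OF that] by auto
  have "(\<Sum>i<length ts - 1. dist (\<gamma> (ts ! i)) (\<gamma> (ts ! Suc i)))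
      \<le> (\<Sum>i<length ts - 1. g (ts ! Suc i) - g (ts ! i))"
    using ts by (intro sum_mono assms) (auto simp: sorted_iff_nth_mono mem)
  also have "\<dots> = g (ts ! (length ts - 1)) - g (ts ! 0)"
    by (rule sum_lessThan_telescope)
  \<comment> \<open>For the empty list both indices are 0, so the two terms are the same unspecified
    value and cancel.\<close>
  also have "\<dots> \<le> g 1 - g 0"
  proof (cases "ts = []")
    case False
    then show ?thesis
      using mono[of "ts ! (length ts - 1)" 1] mono[of 0 "ts ! 0"] mem[of 0] mem[of "length ts - 1"]
      by simp
  qed (use mono[of 0 1] in simp)
  finally show "(\<Sum>i<length ts - 1. ennreal (dist (\<gamma> (ts ! i)) (\<gamma> (ts ! Suc i)))) \<le> ennreal (g 1 - g 0)"
    by (simp add: sum_ennreal ennreal_leI)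
qed

text \<open>The chord between times 0 and 1 is an inscribed polygon of every competing
  curve.\<close>

lemma dist_le_inner_dist: "ennreal (dist x y) \<le> inner_dist Y x y"
  unfolding inner_dist_def
proof (rule INF_greatest, clarsimp)
  fix \<gamma> :: "real \<Rightarrow> 'a"
  have "ennreal (dist (\<gamma> 0) (\<gamma> 1)) = (\<Sum>i<length [0::real, 1] - 1. ennreal (dist (\<gamma> ([0, 1] ! i)) (\<gamma> ([0, 1] ! Suc i))))"
    by simp
  also have "\<dots> \<le> path_length \<gamma>"
    unfolding path_length_def by (rule SUP_upper) simp
  finally show "ennreal (dist (pathstart \<gamma>) (pathfinish \<gamma>)) \<le> path_length \<gamma>"
    by (simp add: pathstart_def pathfinish_def)
qed

section \<open>Rank under matrix products\<close>

lemma rank_mult_le_right: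
  fixes A :: "'a::field^'n^'m" and B :: "'a^'p^'n"
  shows "rank (A ** B) \<le> rank B"
proof -
  have "(A ** B) $ i \<in> vec.span (rows B)" for i
  proof -
    have "(A ** B) $ i = (\<Sum>k\<in>UNIV. A $ i $ k *s (B $ k))"
      by (simp add: vec_eq_iff matrix_matrix_mult_def)
    also have "\<dots> \<in> vec.span (rows B)"
      by (intro vec.span_sum vec.span_scale vec.span_base) (auto simp: rows_def row_def)
    finally show ?thesis .
  qed
  then have "rows (A ** B) \<subseteq> vec.span (rows B)"
    by (auto simp: rows_def row_def)
  then show ?thesis
    unfolding row_rank_def_gen using vec.dim_mono by blast
qed

lemma rank_mult_le_left:
  fixes A :: "'a::field^'n^'m" and B :: "'a^'p^'n"
  shows "rank (A ** B) \<le> rank A"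
proof -
  have "row i (A ** B) = transpose B *v row i A" for i
    by (simp add: row_def vec_eq_iff matrix_matrix_mult_def matrix_vector_mult_def transpose_def mult.commute)
  then have "rows (A ** B) = (*v) (transpose B) ` rows A"
    by (auto simp: rows_def)
  then show ?thesis
    unfolding row_rank_def_gen
    by (metis vec.dim_image_le matrix_vector_mul_linear_gen)
qed

lemma rank_mult_invertible_right:
  fixes A :: "'a::field^'n^'m"
  assumes "invertible S"
  shows "rank (A ** S) = rank A"
proof -
  obtain T where "S ** T = mat 1" using assms by (auto simp: invertible_def)
  then have "A = (A ** S) ** T" by (simp add: matrix_mul_assoc[symmetric])
  then show ?thesis by (metis rank_mult_le_left order_antisym)
qed

lemma rank_mult_invertible_left:
  fixes A :: "'a::field^'n^'m"
  assumes "invertible S"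
  shows "rank (S ** A) = rank A"
proof -
  obtain T where "T ** S = mat 1" using assms by (auto simp: invertible_def)
  then have "A = T ** (S ** A)" by (simp add: matrix_mul_assoc)
  then show ?thesis by (metis rank_mult_le_right order_antisym)
qed

section \<open>Continuity of the matrix operations\<close>

lemma bounded_bilinear_matrix_mult:
  "bounded_bilinear ((**) :: 'k::{real_normed_field,euclidean_space}^'n^'m \<Rightarrow> 'k^'p^'n \<Rightarrow> 'k^'p^'m)"
  unfolding bilinear_conv_bounded_bilinear[symmetric] bilinear_def
  by (auto intro!: linearI simp: matrix_matrix_mult_def vec_eq_iff algebra_simps sum.distrib scaleR_sum_right)

interpretation matrix_mult: bounded_bilinear
  "(**) :: 'k::{real_normed_field,euclidean_space}^'n^'m \<Rightarrow> 'k^'p^'n \<Rightarrow> 'k^'p^'m"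
  by (rule bounded_bilinear_matrix_mult)

lemma bounded_linear_transpose:
  "bounded_linear (transpose :: 'k::{real_normed_field,euclidean_space}^'n^'m \<Rightarrow> 'k^'m^'n)"
  unfolding linear_conv_bounded_linear[symmetric]
  by (auto intro!: linearI simp: transpose_def vec_eq_iff)

lemma inner_transpose: "inner (transpose A) (transpose B) = inner A B"
  unfolding inner_vec_def transpose_def by (simp, rule sum.swap)

section \<open>Contractions from the identity\<close>

text \<open>For a projector \<open>P\<close> this fixes the range of \<open>P\<close> and multiplies
  its kernel by \<open>1 - t\<close>.\<close>

definition blend :: "real \<Rightarrow> 'k::real_normed_field^'n^'n \<Rightarrow> 'k^'n^'n" where
  "blend t P = (1 - t) *\<^sub>R mat 1 + t *\<^sub>R P"

text \<open>The determinant is a polynomial in \<open>t\<close> with value 1 at 0, so it has only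
  finitely many roots.\<close>

lemma finite_singular_blend:
  fixes C :: "'k::real_normed_field^'n^'n"
  shows "finite {t. \<not> invertible (blend t C)}"
proof -
  \<comment> \<open>\<open>M i j\<close> is an entry of the blend as a polynomial in
    \<open>t\<close>, and \<open>p\<close> is the Leibniz expansion of its determinant.\<close>
  define M where "M i j = [: mat 1 $ i $ j, C $ i $ j - mat 1 $ i $ j :]" for i j
  define p where "p = (\<Sum>\<pi> | \<pi> permutes UNIV. of_int (sign \<pi>) * (\<Prod>i\<in>UNIV. M i (\<pi> i)))"
  have p: "poly p (of_real t) = det (blend t C)" for t
    unfolding p_def det_def
    by (simp add: M_def blend_def poly_sum poly_prod scaleR_conv_of_real[where 'a = 'k] algebra_simps)
  have "poly p 0 = 1" using p[of 0] by (simp add: blend_def)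
  then have "finite {x. poly p x = 0}"
    by (intro poly_roots_finite) auto
  then have "finite (of_real -` {x. poly p x = 0} :: real set)"
    by (rule finite_vimageI) (simp add: inj_on_def)
  then show ?thesis
    by (simp add: invertible_det_nz p vimage_def)
qed

section \<open>Orthogonal projectors\<close>

text \<open>\<open>inner\<close> is the real inner product. For complex matrices, replacing
  \<open>x\<close> by its multiple by the imaginary unit shows that the condition amounts to
  \<open>P\<close> being Hermitian.\<close>

definition orth_projector :: "'k::{real_normed_field,euclidean_space}^'m^'m \<Rightarrow> bool" where
  "orth_projector P \<longleftrightarrow> P ** P = P \<and> (\<forall>x y. inner (P *v x) y = inner x (P *v y))"

text \<open>The inner product of matrices is a sum over columns, and left multiplication acts on
  each column separately.\<close>

lemma orth_projector_inner:
  fixes A B :: "'k::{real_normed_field,euclidean_space}^'n^'m"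
  assumes "orth_projector P"
  shows "inner (P ** A) B = inner A (P ** B)"
proof -
  have col: "transpose (P ** A) $ j = P *v (transpose A $ j)" for A :: "'k^'n^'m" and j
    by (simp add: transpose_def vec_eq_iff matrix_matrix_mult_def matrix_vector_mult_def)
  have "inner (transpose (P ** A)) (transpose B) = inner (transpose A) (transpose (P ** B))"
    using assms unfolding inner_vec_def[of "transpose _"] col by (simp add: orth_projector_def)
  then show ?thesis by (simp add: inner_transpose)
qed

text \<open>Transposition preserves the inner product and exchanges left and right factors; no
  conjugation enters, even for complex matrices.\<close>

lemma orth_projector_transpose_inner:
  fixes A B :: "'k::{real_normed_field,euclidean_space}^'m^'n"
  assumes "orth_projector P"
  shows "inner (A ** transpose P) B = inner A (B ** transpose P)"
  using orth_projector_inner[OF assms, of "transpose A" "transpose B"]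
  by (metis inner_transpose matrix_transpose_mul transpose_transpose)

text \<open>Since the squared norm of \<open>P\<close> is its inner product with the identity,
  Cauchy--Schwarz bounds it; the defining equations are closed conditions. Compactness supplies a
  limit projector when \<open>A\<close> and \<open>B\<close> are only limits of matrices of rank
  \<open>r\<close>.\<close>

lemma compact_orth_projectors:
  "compact {P :: 'k::{real_normed_field,euclidean_space}^'m^'m. orth_projector P}"
proof -
  have "norm P \<le> norm (mat 1 :: 'k^'m^'m)" if P: "orth_projector P" for P :: "'k^'m^'m"
  proof -
    have "(norm P)\<^sup>2 = inner (P ** mat 1) (P ** mat 1)"
      by (simp add: power2_norm_eq_inner)
    also have "\<dots> = inner (mat 1) P"
      using P unfolding orth_projector_inner[OF P] by (simp add: orth_projector_def)
    also have "\<dots> \<le> norm (mat 1 :: 'k^'m^'m) * norm P"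
      by (rule norm_cauchy_schwarz)
    finally show ?thesis
      by (cases "P = 0") (simp_all add: power2_eq_square)
  qed
  then have "bounded {P :: 'k^'m^'m. orth_projector P}"
    by (auto simp: bounded_iff)
  moreover have "closed {P :: 'k^'m^'m. orth_projector P}"
  proof -
    have "bounded_linear (\<lambda>P :: 'k^'m^'m. P *v x)" for x :: "'k^'m"
      unfolding linear_conv_bounded_linear[symmetric]
      by (auto intro!: linearI simp: matrix_vector_mult_def vec_eq_iff algebra_simps sum.distrib scaleR_sum_right)
    then have cont: "continuous_on UNIV (\<lambda>P :: 'k^'m^'m. P *v x)" for x :: "'k^'m"
      using linear_continuous_on by blast
    have "closed {P :: 'k^'m^'m. P ** P = P}"
      by (intro closed_Collect_eq matrix_mult.continuous_on continuous_on_id)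
    moreover have "closed {P :: 'k^'m^'m. inner (P *v x) y = inner x (P *v y)}" for x y
      by (intro closed_Collect_eq continuous_on_inner continuous_on_const cont)
    ultimately show ?thesis
      unfolding orth_projector_def by (intro closed_Collect_conj closed_Collect_all)
  qed
  ultimately show ?thesis by (simp add: compact_eq_bounded_closed)
qed

text \<open>The projector onto the column space of \<open>B\<close> is obtained as the point of the space
  of all products \<open>B Y\<close> that is closest to the identity matrix.\<close>

lemma ex_orth_projector:
  fixes B :: "'k::{real_normed_field,euclidean_space}^'n^'m"
  assumes cj: "\<And>a x y :: 'k. inner (a * x) y = inner x (cj a * y)"
  obtains P Y where "orth_projector P" "P ** B = B" "P = B ** Y"
proof -
  let ?S = "range (\<lambda>Y :: 'k^'m^'n. B ** Y)"
  have "linear (\<lambda>Y :: 'k^'m^'n. B ** Y)"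
    by (intro linearI matrix_mult.add_right matrix_mult.scaleR_right)
  then have "subspace ?S" by (rule linear_subspace_image) simp
  then obtain P Z where P: "P \<in> ?S" and Z: "\<And>w. w \<in> ?S \<Longrightarrow> orthogonal Z w" and PZ: "mat 1 = P + Z"
    using orthogonal_subspace_decomp_exists[of ?S "mat 1"] by (metis span_eq_iff)
  have ZB: "inner (Z *v y) (B *v w) = 0" for y w
  proof -
    \<comment> \<open>\<open>Y\<close> is the column \<open>w\<close> times the conjugated row
      \<open>y\<close>, chosen so that the inner product of \<open>Z *v y\<close> and
      \<open>B *v w\<close> equals that of \<open>Z\<close> and \<open>B ** Y\<close>.\<close>
    define Y where "Y = (\<chi> i j. cj (y $ j) * w $ i)"
    have "inner (Z *v y) (B *v w) = (\<Sum>i\<in>UNIV. \<Sum>j\<in>UNIV. inner (Z $ i $ j) (cj (y $ j) * (\<Sum>k\<in>UNIV. B $ i $ k * w $ k)))"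
      by (simp add: inner_vec_def matrix_vector_mult_def inner_sum_left cj[symmetric] mult.commute)
    also have "\<dots> = inner Z (B ** Y)"
      by (simp add: inner_vec_def matrix_matrix_mult_def Y_def sum_distrib_left mult_ac)
    also have "\<dots> = 0" using Z[of "B ** Y"] by (simp add: orthogonal_def)
    finally show ?thesis .
  qed
  obtain Y where Y: "P = B ** Y" using P by blast
  have split: "x = P *v x + Z *v x" for x
    by (metis PZ matrix_vector_mul_lid matrix_vector_mult_add_rdistrib)
  have ZP: "inner (Z *v y) (P *v x) = 0" for x y
    using ZB[of y "Y *v x"] by (simp add: Y matrix_vector_mul_assoc)
  \<comment> \<open>The right-hand side is symmetric in \<open>x\<close> and \<open>y\<close>, which
    gives self-adjointness.\<close>
  have P_inner: "inner (P *v x) y = inner (P *v x) (P *v y)" for x y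
    using ZP[of y x] by (subst split[of y]) (simp add: inner_add_right inner_commute)
  then have sa: "inner (P *v x) y = inner x (P *v y)" for x y
    by (metis inner_commute)
  \<comment> \<open>This vector equals \<open>B x - P B x\<close>, so it lies in the column space of
    \<open>B\<close>, to which all values of \<open>Z\<close> are orthogonal; hence it is orthogonal
    to itself.\<close>
  have Z0: "Z *v (B *v x) = 0" for x
  proof -
    have "inner (Z *v (B *v x)) (Z *v (B *v x)) = inner (Z *v (B *v x)) (B *v x - P *v (B *v x))"
      using split[of "B *v x"] by (metis add_diff_cancel_left')
    also have "\<dots> = 0"
      by (simp add: inner_diff_right ZB ZP)
    finally show ?thesis by simp
  qed
  have "P ** B = B"
    unfolding matrix_eq using split Z0 by (metis add.right_neutral matrix_vector_mul_assoc)
  moreover from this have "P ** P = P"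
    by (metis Y matrix_mul_assoc)
  ultimately show thesis
    using that[of P Y] sa Y by (simp add: orth_projector_def)
qed

section \<open>Deformation paths in the closure of a stratum\<close>

text \<open>The map \<open>\<tau>\<close> assigns to the factor acting from the left the one acting from the right; the map
  \<open>cj\<close> is the conjugation of the scalars.\<close>

locale congruence_family =
  fixes X :: "('k::{real_normed_field,euclidean_space}^'n^'m) set"
    and \<tau> :: "'k^'m^'m \<Rightarrow> 'k^'n^'n"
    and cj :: "'k \<Rightarrow> 'k"
  assumes inner_cj: "\<And>a x y :: 'k. inner (a * x) y = inner x (cj a * y)"
    and subspace_X: "subspace X"
    and continuous_\<tau>: "continuous_on UNIV \<tau>"
    and \<tau>_blend: "\<And>t P. \<tau> (blend t P) = blend t (\<tau> P)"
    and \<tau>_idem: "\<And>P. P ** P = P \<Longrightarrow> \<tau> P ** \<tau> P = \<tau> P"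
    and \<tau>_inner: "\<And>P (A :: 'k^'n^'m) B. orth_projector P \<Longrightarrow> inner (A ** \<tau> P) B = inner A (B ** \<tau> P)"
    and \<tau>_fix: "\<And>P B. B \<in> X \<Longrightarrow> P ** B = B \<Longrightarrow> B ** \<tau> P = B"
    and congruence: "\<And>A S. A \<in> X \<Longrightarrow> S ** A ** \<tau> S \<in> X"
begin

text \<open>Both curves arise from a matrix of rank exactly \<open>r\<close> by multiplication with
  blends, which are invertible for all but finitely many \<open>t\<close>.\<close>

lemma projector_paths_in_stratum:
  assumes A: "A \<in> rank_stratum X r" and B: "B \<in> rank_stratum X r"
  obtains P where "orth_projector P" "P ** B = B"
    "\<And>t. blend t P ** A ** blend t (\<tau> P) \<in> closure (rank_stratum X r)"
    "\<And>t. (1 - t) *\<^sub>R B + t *\<^sub>R (P ** A ** \<tau> P) \<in> closure (rank_stratum X r)"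
proof -
  obtain P Y where P: "orth_projector P" "P ** B = B" "P = B ** Y"
    using ex_orth_projector[OF inner_cj] .
  have 1: "blend t P ** A ** blend t (\<tau> P) \<in> closure (rank_stratum X r)" for t
  proof (rule closure_cofiniteI[of "\<lambda>t. blend t P ** A ** blend t (\<tau> P)"])
    show "continuous_on UNIV (\<lambda>t. blend t P ** A ** blend t (\<tau> P))"
      unfolding blend_def by (intro matrix_mult.continuous_on continuous_intros)
    show "finite ({t. \<not> invertible (blend t P)} \<union> {t. \<not> invertible (blend t (\<tau> P))})"
      by (simp add: finite_singular_blend)
  qed (use A congruence[of A "blend _ P"] in
      \<open>auto simp: rank_stratum_def \<tau>_blend rank_mult_invertible_left rank_mult_invertible_right\<close>)
  \<comment> \<open>Because \<open>P = B ** Y\<close>, the endpoint of the segment is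
    \<open>B ** N\<close>, and the whole segment is \<open>B ** blend t N\<close>.\<close>
  define N where "N = Y ** A ** \<tau> P"
  have N: "P ** A ** \<tau> P = B ** N" by (simp add: N_def P(3) matrix_mul_assoc)
  then have "B ** N \<in> X" using A congruence[of A P] by (simp add: rank_stratum_def)
  moreover have BN: "(1 - t) *\<^sub>R B + t *\<^sub>R (B ** N) = B ** blend t N" for t
    by (simp add: blend_def matrix_mult.add_right matrix_mult.scaleR_right)
  ultimately have "B ** blend t N \<in> X" for t
    using B subspace_X unfolding rank_stratum_def
    by (metis (no_types, lifting) mem_Collect_eq subspace_add subspace_scale)
  moreover have "continuous_on UNIV (\<lambda>t. B ** blend t N)"
    unfolding blend_def by (intro matrix_mult.continuous_on continuous_intros)
  ultimately have "B ** blend t N \<in> closure (rank_stratum X r)" for t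
    using B by (intro closure_cofiniteI[of "\<lambda>t. B ** blend t N" "{t. \<not> invertible (blend t N)}"])
      (auto simp: finite_singular_blend rank_stratum_def rank_mult_invertible_right)
  then have "(1 - t) *\<^sub>R B + t *\<^sub>R (P ** A ** \<tau> P) \<in> closure (rank_stratum X r)" for t
    by (simp only: N BN)
  with P(1,2) 1 show thesis by (rule that)
qed

text \<open>Rank may drop in the limit, so \<open>P\<close> is a limit of projectors belonging to
  approximants, and its range may exceed the column space of \<open>B\<close>. The listed properties
  pass to the limit by continuity and closedness.\<close>

lemma projector_paths:
  assumes A: "A \<in> closure (rank_stratum X r)" and B: "B \<in> closure (rank_stratum X r)"
  obtains P where "orth_projector P" "P ** B = B" "B ** \<tau> P = B"
    "\<And>t. blend t P ** A ** blend t (\<tau> P) \<in> closure (rank_stratum X r)"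
    "\<And>t. (1 - t) *\<^sub>R B + t *\<^sub>R (P ** A ** \<tau> P) \<in> closure (rank_stratum X r)"
proof -
  obtain a b where a: "\<And>i. a i \<in> rank_stratum X r" "a \<longlonglongrightarrow> A"
    and b: "\<And>i. b i \<in> rank_stratum X r" "b \<longlonglongrightarrow> B"
    using A B by (auto simp: closure_sequential)
  have "\<exists>P. orth_projector P \<and> P ** b i = b i \<and>
      (\<forall>t. blend t P ** a i ** blend t (\<tau> P) \<in> closure (rank_stratum X r)) \<and>
      (\<forall>t. (1 - t) *\<^sub>R b i + t *\<^sub>R (P ** a i ** \<tau> P) \<in> closure (rank_stratum X r))" for i
    using projector_paths_in_stratum[OF a(1) b(1), of i i] by metis
  then obtain p where p: "\<And>i. orth_projector (p i)" "\<And>i. p i ** b i = b i"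
      "\<And>i t. blend t (p i) ** a i ** blend t (\<tau> (p i)) \<in> closure (rank_stratum X r)"
      "\<And>i t. (1 - t) *\<^sub>R b i + t *\<^sub>R (p i ** a i ** \<tau> (p i)) \<in> closure (rank_stratum X r)"
    by metis
  obtain P \<rho> where P: "orth_projector P" and \<rho>: "strict_mono \<rho>" "(p \<circ> \<rho>) \<longlonglongrightarrow> P"
    using compact_orth_projectors p(1) unfolding compact_def by (metis (mono_tags, lifting) mem_Collect_eq)
  have lim: "(\<lambda>i. a (\<rho> i)) \<longlonglongrightarrow> A" "(\<lambda>i. b (\<rho> i)) \<longlonglongrightarrow> B" "(\<lambda>i. p (\<rho> i)) \<longlonglongrightarrow> P"
    using LIMSEQ_subseq_LIMSEQ[OF a(2) \<rho>(1)] LIMSEQ_subseq_LIMSEQ[OF b(2) \<rho>(1)] \<rho>(2)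
    by (simp_all add: o_def)
  have lim\<tau>: "(\<lambda>i. \<tau> (p (\<rho> i))) \<longlonglongrightarrow> \<tau> P"
    using continuous_\<tau> lim(3) continuous_on_tendsto_compose[of UNIV \<tau>] by auto
  show thesis
  proof (rule that[OF P])
    have "(\<lambda>i. p (\<rho> i) ** b (\<rho> i)) \<longlonglongrightarrow> P ** B"
      by (intro matrix_mult.tendsto lim)
    then show "P ** B = B" using lim(2) p(2) LIMSEQ_unique by simp
    \<comment> \<open>\<open>\<tau>_fix\<close> is applied to the approximants, which lie in
      \<open>X\<close>, and the identity is then passed to the limit.\<close>
    have "(\<lambda>i. b (\<rho> i) ** \<tau> (p (\<rho> i))) \<longlonglongrightarrow> B ** \<tau> P"
      by (intro matrix_mult.tendsto lim lim\<tau>)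
    moreover have "b (\<rho> i) ** \<tau> (p (\<rho> i)) = b (\<rho> i)" for i
      using b(1)[of "\<rho> i"] p(2) by (simp add: \<tau>_fix rank_stratum_def)
    ultimately show "B ** \<tau> P = B" using lim(2) LIMSEQ_unique by simp
    fix t
    have "(\<lambda>i. blend t (p (\<rho> i)) ** a (\<rho> i) ** blend t (\<tau> (p (\<rho> i))))
        \<longlonglongrightarrow> blend t P ** A ** blend t (\<tau> P)"
      unfolding blend_def by (intro matrix_mult.tendsto tendsto_intros lim lim\<tau>)
    then show "blend t P ** A ** blend t (\<tau> P) \<in> closure (rank_stratum X r)"
      by (rule Lim_in_closed_set[OF closed_closure always_eventually[OF allI[OF p(3)]] sequentially_bot])
    have "(\<lambda>i. (1 - t) *\<^sub>R b (\<rho> i) + t *\<^sub>R (p (\<rho> i) ** a (\<rho> i) ** \<tau> (p (\<rho> i))))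
        \<longlonglongrightarrow> (1 - t) *\<^sub>R B + t *\<^sub>R (P ** A ** \<tau> P)"
      by (intro matrix_mult.tendsto tendsto_intros lim lim\<tau>)
    then show "(1 - t) *\<^sub>R B + t *\<^sub>R (P ** A ** \<tau> P) \<in> closure (rank_stratum X r)"
      by (rule Lim_in_closed_set[OF closed_closure always_eventually[OF allI[OF p(4)]] sequentially_bot])
  qed
qed

lemma inner_dist_le:
  assumes A: "A \<in> closure (rank_stratum X r)" and B: "B \<in> closure (rank_stratum X r)"
  shows "inner_dist (closure (rank_stratum X r)) A B \<le> ennreal (sqrt 3 * dist A B)"
proof -
  obtain P where P: "orth_projector P" and PB: "P ** B = B" "B ** \<tau> P = B"
    and path1: "\<And>t. blend t P ** A ** blend t (\<tau> P) \<in> closure (rank_stratum X r)"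
    and path2: "\<And>t. (1 - t) *\<^sub>R B + t *\<^sub>R (P ** A ** \<tau> P) \<in> closure (rank_stratum X r)"
    using projector_paths[OF A B] by metis
  define Q where "Q = \<tau> P"
  define a where "a = P ** A ** Q"
  define b where "b = P ** A ** (mat 1 - Q) + (mat 1 - P) ** A ** Q"
  define c where "c = (mat 1 - P) ** A ** (mat 1 - Q)"
  have PP: "P ** P = P" using P by (simp add: orth_projector_def)
  have QQ: "Q ** Q = Q" using \<tau>_idem PP by (simp add: Q_def)
  have inP: "inner (P ** U) V = inner U (P ** V)" for U V :: "'k^'n^'m"
    using P by (rule orth_projector_inner)
  have inQ: "inner (U ** Q) V = inner U (V ** Q)" for U V :: "'k^'n^'m"
    using P unfolding Q_def by (rule \<tau>_inner)
  note bil = matrix_mult.diff_left matrix_mult.diff_right matrix_mult.add_left matrix_mult.add_right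
    matrix_mult.scaleR_left matrix_mult.scaleR_right
  have assoc: "U ** V ** Q ** Q = U ** V ** Q" for U :: "'k^'m^'m" and V :: "'k^'n^'m"
    by (metis QQ matrix_mul_assoc)
  have assoc': "V ** Q ** Q = V ** Q" for V :: "'k^'n^'m"
    by (metis QQ matrix_mul_assoc)
  have Pc: "P ** c = 0" and cQ: "c ** Q = 0"
    by (simp_all add: c_def bil matrix_mul_assoc PP assoc assoc')
  have "P ** (P ** A ** (mat 1 - Q)) ** Q = 0" "P ** ((mat 1 - P) ** A ** Q) ** Q = 0"
    by (simp_all add: bil matrix_mul_assoc PP assoc)
  then have PbQ: "P ** b ** Q = 0"
    unfolding b_def by (simp only: matrix_mult.add_left matrix_mult.add_right add_0)
  have Pa: "P ** (a - B) ** Q = a - B"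
    using PB[folded Q_def] by (simp add: a_def bil matrix_mul_assoc PP assoc)
  \<comment> \<open>Taking \<open>V\<close> to \<open>P ** V ** Q\<close> is self-adjoint and fixes
    \<open>a - B\<close>, so \<open>a - B\<close> is orthogonal to everything this map
    kills.\<close>
  have ortho: "inner (a - B) V = 0" if "P ** V ** Q = 0" for V
  proof -
    have "inner (a - B) V = inner (P ** (a - B) ** Q) V" by (simp add: Pa)
    also have "\<dots> = inner (a - B) (P ** (V ** Q))" by (simp only: inP inQ)
    also have "\<dots> = 0" by (simp add: that matrix_mul_assoc)
    finally show ?thesis .
  qed
  have ab: "inner (a - B) b = 0" using PbQ by (rule ortho)
  have ac: "inner (a - B) c = 0" by (rule ortho) (simp add: Pc)
  \<comment> \<open>One summand of \<open>b\<close> starts with \<open>P\<close> and the other ends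
    with \<open>Q\<close>; moved across the inner product, either factor annihilates
    \<open>c\<close>.\<close>
  have bc: "inner b c = 0"
  proof -
    have "inner (P ** (A ** (mat 1 - Q))) c = 0" by (simp only: inP Pc inner_zero_right)
    moreover have "inner ((mat 1 - P) ** A ** Q) c = 0" by (simp only: inQ cQ inner_zero_right)
    ultimately show ?thesis by (simp add: b_def inner_add_left matrix_mul_assoc)
  qed
  have A_eq: "A = a + b + c" by (simp add: a_def b_def c_def bil)
  have "(dist A B)\<^sup>2 = (norm ((a - B) + b + c))\<^sup>2"
    by (simp add: dist_norm A_eq algebra_simps)
  also have "\<dots> = (norm (a - B))\<^sup>2 + (norm b)\<^sup>2 + (norm c)\<^sup>2"
    unfolding power2_norm_eq_inner using ab ac bc
    by (simp add: inner_add_left inner_add_right inner_commute)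
  finally have pyth: "(dist A B)\<^sup>2 = (norm (a - B))\<^sup>2 + (norm b)\<^sup>2 + (norm c)\<^sup>2" .
  \<comment> \<open>Cauchy--Schwarz for three summands\<close>
  have "(norm b + norm c + norm (a - B))\<^sup>2 \<le> (sqrt 3 * dist A B)\<^sup>2"
    using zero_le_power2[of "norm b - norm c"] zero_le_power2[of "norm c - norm (a - B)"]
      zero_le_power2[of "norm b - norm (a - B)"]
    unfolding power_mult_distrib pyth by (simp add: power2_eq_square algebra_simps)
  then have len: "norm b + norm c + norm (a - B) \<le> sqrt 3 * dist A B"
    by (rule power2_le_imp_le) simp
  \<comment> \<open>\<open>u\<close> drives the deformation of \<open>A\<close> to \<open>P A Q\<close> up to time \<open>1/2\<close>, then \<open>v\<close> the segment to \<open>B\<close>\<close>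
  define u where "u t = max 0 (1 - 2 * t)" for t :: real
  define v where "v t = max 0 (2 * t - 1)" for t :: real
  define \<gamma> where "\<gamma> t = a + u t *\<^sub>R b + (u t)\<^sup>2 *\<^sub>R c + v t *\<^sub>R (B - a)" for t
  \<comment> \<open>On the unit interval \<open>u\<close> and its square decrease while
    \<open>v\<close> increases; with these signs the increments of \<open>g\<close> are the summed
    lengths of the moves along \<open>b\<close>, \<open>c\<close> and \<open>a - B\<close>.\<close>
  define g where "g t = v t * norm (a - B) - u t * norm b - (u t)\<^sup>2 * norm c" for t
  have "dist (\<gamma> s) (\<gamma> t) \<le> g t - g s" if "0 \<le> s" "s \<le> t" "t \<le> 1" for s t
  proof -
    have u: "u t \<le> u s" "0 \<le> u t" and v: "v s \<le> v t" using that by (auto simp: u_def v_def)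
    then have u2: "(u t)\<^sup>2 \<le> (u s)\<^sup>2" by (intro power_mono)
    have "\<gamma> s - \<gamma> t = (u s - u t) *\<^sub>R b + ((u s)\<^sup>2 - (u t)\<^sup>2) *\<^sub>R c + (v t - v s) *\<^sub>R (a - B)"
      by (simp add: \<gamma>_def algebra_simps)
    also have "norm \<dots> \<le> norm ((u s - u t) *\<^sub>R b) + norm (((u s)\<^sup>2 - (u t)\<^sup>2) *\<^sub>R c) + norm ((v t - v s) *\<^sub>R (a - B))"
      by (intro order_trans[OF norm_triangle_ineq] add_right_mono norm_triangle_ineq)
    also have "\<dots> = g t - g s"
      unfolding norm_scaleR g_def using u v u2 by (simp add: left_diff_distrib)
    finally show ?thesis by (simp add: dist_norm)
  qed
  then have "path_length \<gamma> \<le> ennreal (g 1 - g 0)" by (rule path_length_le)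
  also have "g 1 - g 0 = norm b + norm c + norm (a - B)" by (simp add: g_def u_def v_def)
  finally have length: "path_length \<gamma> \<le> ennreal (sqrt 3 * dist A B)"
    using len by (meson ennreal_leI order_trans)
  have "\<gamma> t \<in> closure (rank_stratum X r)" for t
  proof (cases "t \<le> 1 / 2")
    case True
    \<comment> \<open>\<open>blend (1 - u t) P\<close> is \<open>P + u t (1 - P)\<close>, and
      likewise for \<open>Q\<close>; each complementary factor contributes one power of
      \<open>u t\<close>.\<close>
    have "blend (1 - u t) P ** A ** blend (1 - u t) Q = a + u t *\<^sub>R b + (u t)\<^sup>2 *\<^sub>R c"
      by (simp add: blend_def a_def b_def c_def bil algebra_simps power2_eq_square)
    with True path1[of "1 - u t"] show ?thesis by (simp add: \<gamma>_def v_def Q_def)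
  next
    case False
    \<comment> \<open>\<open>path2\<close> starts at \<open>B\<close>, so it is traversed
      backwards.\<close>
    have "(1 - (1 - v t)) *\<^sub>R B + (1 - v t) *\<^sub>R a = a + v t *\<^sub>R (B - a)"
      by (simp add: algebra_simps)
    with False path2[of "1 - v t"] show ?thesis by (simp add: \<gamma>_def u_def a_def Q_def)
  qed
  moreover have "path \<gamma>"
    unfolding path_def \<gamma>_def u_def v_def by (intro continuous_intros)
  moreover have "path_length \<gamma> < \<infinity>"
    using length by (simp add: le_less_trans)
  moreover have "pathstart \<gamma> = A" "pathfinish \<gamma> = B"
    by (simp_all add: pathstart_def pathfinish_def \<gamma>_def u_def v_def A_eq)
  ultimately have "inner_dist (closure (rank_stratum X r)) A B \<le> path_length \<gamma>"
    unfolding inner_dist_def rectifiable_path_def path_image_def by (intro INF_lower) auto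
  with length show ?thesis by (rule order_trans[rotated])
qed

lemma inner_dist_bounds:
  assumes A: "A \<in> closure (rank_stratum X r)" and B: "B \<in> closure (rank_stratum X r)"
  shows "inner_dist (closure (rank_stratum X r)) A B / ennreal (2 * sqrt 2) \<le> ennreal (dist A B) \<and>
    ennreal (dist A B) \<le> inner_dist (closure (rank_stratum X r)) A B"
proof
  \<comment> \<open>As 3 \<le> 8, the bound already obtained is sharper than the required
    one.\<close>
  have "sqrt 3 \<le> 2 * sqrt 2"
    by (rule real_le_lsqrt) (auto simp: power_mult_distrib)
  then have "inner_dist (closure (rank_stratum X r)) A B \<le> ennreal (2 * sqrt 2 * dist A B)"
    by (intro order_trans[OF inner_dist_le[OF A B]] ennreal_leI mult_right_mono) auto
  then have "inner_dist (closure (rank_stratum X r)) A B / ennreal (2 * sqrt 2)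
      \<le> ennreal (2 * sqrt 2 * dist A B) / ennreal (2 * sqrt 2)"
    by (rule divide_right_mono_ennreal)
  also have "\<dots> = ennreal (dist A B)"
    by (subst divide_ennreal) auto
  finally show "inner_dist (closure (rank_stratum X r)) A B / ennreal (2 * sqrt 2) \<le> ennreal (dist A B)" .
qed (rule dist_le_inner_dist)

end

section \<open>The three families of matrix spaces\<close>

text \<open>With no symmetry to preserve, contraction from the left suffices, and the right factor
  stays the identity.\<close>

lemma congruence_family_UNIV:
  fixes cj :: "'k::{real_normed_field,euclidean_space} \<Rightarrow> 'k"
  assumes "\<And>a x y. inner (a * x) y = inner x (cj a * y)"
  shows "congruence_family (UNIV :: ('k^'n^'m) set) (\<lambda>_. mat 1) cj"
  using assms by unfold_locales (auto simp: blend_def algebra_simps)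

lemma congruence_family_transpose:
  fixes cj :: "'k::{real_normed_field,euclidean_space} \<Rightarrow> 'k" and X :: "('k^'n^'n) set"
  assumes cj: "\<And>a x y. inner (a * x) y = inner x (cj a * y)"
    and X: "X \<in> {symmetric_matrices, skew_symmetric_matrices}"
  shows "congruence_family X transpose cj"
proof -
  interpret transpose: bounded_linear "transpose :: 'k^'n^'n \<Rightarrow> 'k^'n^'n"
    by (rule bounded_linear_transpose)
  \<comment> \<open>The sign is 1 for symmetric and -1 for skew-symmetric matrices, so one argument
    covers both.\<close>
  obtain \<epsilon> :: real where X_eq: "X = {A. transpose A = \<epsilon> *\<^sub>R A}" and \<epsilon>: "\<epsilon> * \<epsilon> = 1"
  proof (cases "X = symmetric_matrices")
    case True
    then show thesis by (intro that[of 1]) (auto simp: symmetric_matrices_def)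
  next
    case False
    then show thesis using X by (intro that[of "-1"]) (auto simp: skew_symmetric_matrices_def)
  qed
  show ?thesis
  proof
    show "subspace X"
      by (auto simp: X_eq subspace_def transpose.zero transpose.add transpose.scaleR scaleR_add_right)
    \<comment> \<open>Transposing \<open>P ** B = B\<close> gives the claim up to the sign on both
      sides; a second multiplication by the sign removes it.\<close>
    show "B ** transpose P = B" if "B \<in> X" "P ** B = B" for P B
    proof -
      have "\<epsilon> *\<^sub>R (B ** transpose P) = transpose (P ** B)"
        using that(1) by (simp add: X_eq matrix_transpose_mul matrix_mult.scaleR_left)
      then have "\<epsilon> *\<^sub>R \<epsilon> *\<^sub>R (B ** transpose P) = \<epsilon> *\<^sub>R \<epsilon> *\<^sub>R B"
        using that by (simp add: X_eq)
      then show ?thesis by (simp add: \<epsilon>)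
    qed
    show "S ** A ** transpose S \<in> X" if "A \<in> X" for A S
      using that by (simp add: X_eq matrix_transpose_mul matrix_mul_assoc
          matrix_mult.scaleR_left matrix_mult.scaleR_right)
    show "transpose P ** transpose P = transpose P" if "P ** P = P" for P :: "'k^'n^'n"
      using that by (metis matrix_transpose_mul)
    show "transpose (blend t P) = blend t (transpose P)" for t and P :: "'k^'n^'n"
      by (simp add: blend_def transpose.add transpose.scaleR)
  qed (auto simp: cj orth_projector_transpose_inner intro: transpose.continuous_on continuous_on_id)
qed

lemma inner_mult_real: "inner (a * x) y = inner x (a * y)" for a x y :: real
  by simp

lemma inner_mult_complex: "inner (a * x) y = inner x (cnj a * y)" for a x y :: complex
  by (simp add: Inner_Product.inner_complex_def algebra_simps)

theorem theorem4p1: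
  fixes r :: nat
  assumes "1 \<le> r"
  shows
    "(r \<le> CARD('m::finite) \<and> CARD('m) \<le> CARD('n::finite) \<longrightarrow>
       (\<forall>X \<in> {UNIV :: (real^'n^'m) set}.
        \<forall>A \<in> closure (rank_stratum X r). \<forall>B \<in> closure (rank_stratum X r).
          inner_dist (closure (rank_stratum X r)) A B / ennreal (2 * sqrt 2)
            \<le> ennreal (d_out_real A B) \<and>
          ennreal (d_out_real A B) \<le> inner_dist (closure (rank_stratum X r)) A B) \<and>
       (\<forall>X \<in> {UNIV :: (complex^'n^'m) set}.
        \<forall>A \<in> closure (rank_stratum X r). \<forall>B \<in> closure (rank_stratum X r).
          inner_dist (closure (rank_stratum X r)) A B / ennreal (2 * sqrt 2)
            \<le> ennreal (d_out_complex A B) \<and>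
          ennreal (d_out_complex A B) \<le> inner_dist (closure (rank_stratum X r)) A B)) \<and>
     (r \<le> CARD('p::finite) \<longrightarrow>
       (\<forall>X \<in> {symmetric_matrices, skew_symmetric_matrices :: (real^'p^'p) set}.
        \<forall>A \<in> closure (rank_stratum X r). \<forall>B \<in> closure (rank_stratum X r).
          inner_dist (closure (rank_stratum X r)) A B / ennreal (2 * sqrt 2)
            \<le> ennreal (d_out_real A B) \<and>
          ennreal (d_out_real A B) \<le> inner_dist (closure (rank_stratum X r)) A B) \<and>
       (\<forall>X \<in> {symmetric_matrices, skew_symmetric_matrices :: (complex^'p^'p) set}.
        \<forall>A \<in> closure (rank_stratum X r). \<forall>B \<in> closure (rank_stratum X r).
          inner_dist (closure (rank_stratum X r)) A B / ennreal (2 * sqrt 2)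
            \<le> ennreal (d_out_complex A B) \<and>
          ennreal (d_out_complex A B) \<le> inner_dist (closure (rank_stratum X r)) A B))"
  unfolding d_out_real_eq_dist d_out_complex_eq_dist
proof ((rule conjI; rule impI; rule conjI; rule ballI), goal_cases)
  case 1
  then show ?case
    unfolding singleton_iff
    using congruence_family.inner_dist_bounds[OF congruence_family_UNIV[OF inner_mult_real]] by blast
next
  case 2
  then show ?case
    unfolding singleton_iff
    using congruence_family.inner_dist_bounds[OF congruence_family_UNIV[OF inner_mult_complex]] by blast
next
  case 3
  from congruence_family_transpose[OF inner_mult_real this(2)] show ?case
    using congruence_family.inner_dist_bounds by blast
next
  case 4
  from congruence_family_transpose[OF inner_mult_complex this(2)] show ?case
    using congruence_family.inner_dist_bounds by blast
qed

end
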